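(* Let $M=\langle \Sigma, Q, \delta, q_0, q_f\rangle$ be a Bernstein–Vazirani QTM. Then there is a QTM $M'$ such that for every classical initial configuration $C=\langle\alpha,q_0,\beta\rangle$ of $M$ the following holds: if $M$ on input $|C\rangle$ halts in $k$ steps in the final q-configuration $|\phi\rangle=U_M^k|C\rangle$, then $U_{M'}^k|C\rangle=|\phi\rangle$, where every plain configuration $\langle\alpha,q,\beta\rangle$ is identified with the configuration $\langle\alpha,q,\beta,0\rangle$ of $M'$ (counter $0$).
   Context: Tape and plain configurations. A finite tape alphabet $\Sigma$ contains the blank $\Box$ and the symbol $1$. A plain configuration is a triple $\langle\alpha,q,\beta\rangle\in\Sigma^*\times Q\times\Sigma^*$: $q$ is the current state, $\alpha$ the tape content to the left of the head, $\beta$ the content starting at the head cell (the head reads the first symbol of $\beta$, or $\Box$ if $\beta$ is empty); configurations are identified up to adding blanks to the left of $\alpha$ and to the right of $\beta$. For $C=\langle\alpha,q,u\beta,0\rangle$ (current symbol $u$), a state $p$, a symbol $v$ and a direction $d\in\{L,R\}$, let $C_{p,v,d}$ be obtained by writing $v$ in place of $u$, entering state $p$ and moving the head: $C_{p,v,R}=\langle\alpha v,p,\beta\rangle$ and, writing $\alpha=\alpha'w$ ($w=\Box$ if $\alpha$ empty), $C_{p,v,L}=\langle\alpha',p,wv\beta\rangle$ (with counters, the same with a trailing counter $0$). Bernstein–Vazirani QTM (B&V-QTM): a tuple $\langle\Sigma,Q,\delta,q_0,q_f\rangle$ with $\delta:Q\times\Sigma\to\ell^2(Q\times\Sigma\times\{L,R\})$,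 whose time evolution operator $U_M$ on $\ell^2(\Sigma^*\times Q\times\Sigma^* )$ (defined on basis vectors by $U_M|C\rangle=\sum_{p,v,d}\delta(q,u)(p,v,d)|C_{p,v,d}\rangle$ and extended linearly and continuously) is unitary; moreover $\delta(q_f,a)(q_0,a,R)=1$ for every $a\in\Sigma$, $\delta(q_f,a)(q',a',d)=0$ if $(q',a',d)\neq(q_0,a,R)$, and $\delta(q',a')(q_0,a,d)=0$ if $(q',a',d)\neq(q_f,a,R)$. Its inputs are classical configurations $|C\rangle$ with amplitude $1$. $M$ halts in $k$ steps on $|C\rangle$ if $U_M^k|C\rangle$ is a superposition of configurations all in state $q_f$, and for all $i<k$, $U_M^i|C\rangle$ contains no configuration in state $q_f$ (a configuration is "contained" if its coefficient is nonzero). QTM (new notion). A pre-QTM is a tuple $M=\langle\Sigma,Q,Q_s,Q_t,\delta_0,q_i,q_f\rangle$ with $Q$ a finite set of states, $Q_s\subseteq Q$ the source states with initial state $q_i\in Q_s$, $Q_t\subseteq Q$ the target states with final state $q_f\in Q_t$, and $\delta_0:(Q\setminus Q_t)\times\Sigma\to\ell^2((Q\setminus Q_s)\times\Sigma\times\{L,R\})$. A configuration is $\langle\alpha,q,\beta,n\rangle$ with $\langle\alpha,q,\beta\rangle$ a plain configuration and counter $n\in\mathbb{N}$, where $n=0$ whenever $q\notin Q_s\cup Q_t$. The time evolution operator $U_M$ on $\ell^2$ of the set of configurations is the extension of the linear map defined on basis vectors by: (i) if $C=\langle\alpha,q,u\beta,0\rangle$ with $q\notin Q_t$, $U_M|C\rangle=\sum_{(p,v,d)\in(Q\setminus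 Q_s)\times\Sigma\times\{L,R\}}\delta_0(q,u)(p,v,d)|C_{p,v,d}\rangle$ (counter $0$); (ii) if $q\in Q_s$ and $n>0$, $U_M|\langle\alpha,q,\beta,n\rangle\rangle=|\langle\alpha,q,\beta,n-1\rangle\rangle$; (iii) if $q\in Q_t$, $U_M|\langle\alpha,q,\beta,n\rangle\rangle=|\langle\alpha,q,\beta,n+1\rangle\rangle$. A QTM is a pre-QTM whose time evolution operator is unitary. *)

theory Defs
  imports "HOL-Analysis.Analysis" "HOL-Library.Infinite_Typeclass"
begin

section \<open>The Hilbert space of square-summable families\<close>

definition ell2 :: "'c set \<Rightarrow> ('c \<Rightarrow> complex) set" where
  "ell2 X = {f. (\<forall>x. x \<notin> X \<longrightarrow> f x = 0) \<and> (\<lambda>x. (cmod (f x))\<^sup>2) summable_on X}"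

definition ell2_inner :: "'c set \<Rightarrow> ('c \<Rightarrow> complex) \<Rightarrow> ('c \<Rightarrow> complex) \<Rightarrow> complex" where
  "ell2_inner X f g = (\<Sum>\<^sub>\<infinity>x\<in>X. cnj (f x) * g x)"

definition ell2_norm :: "'c set \<Rightarrow> ('c \<Rightarrow> complex) \<Rightarrow> real" where
  "ell2_norm X f = sqrt (\<Sum>\<^sub>\<infinity>x\<in>X. (cmod (f x))\<^sup>2)"

definition ket :: "'c \<Rightarrow> 'c \<Rightarrow> complex" where
  "ket C = (\<lambda>D. if D = C then 1 else 0)"

definition linear_on_ell2 :: "'c set \<Rightarrow> (('c \<Rightarrow> complex) \<Rightarrow> 'c \<Rightarrow> complex) \<Rightarrow> bool" where
  "linear_on_ell2 X U \<longleftrightarrow>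
     (\<forall>f\<in>ell2 X. U f \<in> ell2 X) \<and>
     (\<forall>f\<in>ell2 X. \<forall>g\<in>ell2 X. \<forall>a b.
        U (\<lambda>x. a * f x + b * g x) = (\<lambda>x. a * U f x + b * U g x))"

definition unitary_on_ell2 :: "'c set \<Rightarrow> (('c \<Rightarrow> complex) \<Rightarrow> 'c \<Rightarrow> complex) \<Rightarrow> bool" where
  "unitary_on_ell2 X U \<longleftrightarrow>
     linear_on_ell2 X U \<and>
     (\<forall>f\<in>ell2 X. \<forall>g\<in>ell2 X. ell2_inner X (U f) (U g) = ell2_inner X f g) \<and>
     U ` ell2 X = ell2 X"

text \<open>
  The linear and continuous extension to \<open>ell2 X\<close> of a map \<open>T\<close> given on the basis vectors
  \<open>ket C\<close>, \<open>C \<in> X\<close>, that is \<open>U f = \<Sum>\<^sub>\<infinity>C\<in>X. f C \<cdot> T C\<close>, read off coordinate by coordinate.  The two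
  lemmas after the definition justify the name: the operator has the prescribed values on the basis,
  and every continuous (i.e. bounded) linear operator with these values coincides with it.
\<close>

definition lin_ext :: "'c set \<Rightarrow> ('c \<Rightarrow> 'c \<Rightarrow> complex) \<Rightarrow> ('c \<Rightarrow> complex) \<Rightarrow> 'c \<Rightarrow> complex" where
  "lin_ext X T f = (\<lambda>D. \<Sum>\<^sub>\<infinity>C\<in>X. f C * T C D)"

lemma lin_ext_ket:
  assumes "C \<in> X"
  shows "lin_ext X T (ket C) = T C"
proof
  fix D
  have "(\<Sum>\<^sub>\<infinity>B\<in>X. ket C B * T B D) = (\<Sum>\<^sub>\<infinity>B\<in>{C}. ket C B * T B D)"
    by (rule infsum_cong_neutral) (use assms in \<open>auto simp: ket_def\<close>)
  then show "lin_ext X T (ket C) D = T C D"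
    by (simp add: lin_ext_def ket_def)
qed

lemma ell2_finite_restrict:
  assumes "finite F" "F \<subseteq> X"
  shows "(\<lambda>x. if x \<in> F then f x else 0) \<in> ell2 X"
proof -
  have "(\<lambda>x. (cmod (if x \<in> F then f x else 0))\<^sup>2) summable_on X
        \<longleftrightarrow> (\<lambda>x. (cmod (f x))\<^sup>2) summable_on F"
    by (rule summable_on_cong_neutral) (use assms in auto)
  then show ?thesis
    using assms by (auto simp: ell2_def)
qed

lemma cmod_le_ell2_norm:
  assumes "f \<in> ell2 X"
  shows "cmod (f D) \<le> ell2_norm X f"
proof (cases "D \<in> X")
  case True
  have "(\<Sum>x\<in>{D}. (cmod (f x))\<^sup>2) \<le> (\<Sum>\<^sub>\<infinity>x\<in>X. (cmod (f x))\<^sup>2)"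
    by (rule finite_sum_le_infsum) (use assms True in \<open>auto simp: ell2_def\<close>)
  then show ?thesis
    by (simp add: ell2_norm_def real_le_rsqrt)
next
  case False
  then show ?thesis
    using assms by (auto simp: ell2_def ell2_norm_def infsum_nonneg)
qed

lemma lin_ext_unique:
  assumes lin: "linear_on_ell2 X U"
    and bdd: "\<And>f. f \<in> ell2 X \<Longrightarrow> ell2_norm X (U f) \<le> K * ell2_norm X f"
    and basis: "\<And>C. C \<in> X \<Longrightarrow> U (ket C) = T C"
    and f: "f \<in> ell2 X"
  shows "U f = lin_ext X T f"
proof
  fix D
  define r where "r F = (\<lambda>x. if x \<in> F then f x else 0)" for F
  define s where "s = (\<Sum>\<^sub>\<infinity>x\<in>X. (cmod (f x))\<^sup>2)"
  have rl: "r F \<in> ell2 X" if "finite F" "F \<subseteq> X" for F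
    unfolding r_def by (rule ell2_finite_restrict[OF that])
  have lin': "U (\<lambda>x. a * g x + b * h x) = (\<lambda>x. a * U g x + b * U h x)"
    if "g \<in> ell2 X" "h \<in> ell2 X" for a b g h
    using lin that by (auto simp: linear_on_ell2_def)
  have kl: "ket C \<in> ell2 X" if "C \<in> X" for C
  proof -
    have "ket C = (\<lambda>x. if x \<in> {C} then (1::complex) else 0)" by (auto simp: ket_def)
    then show ?thesis using ell2_finite_restrict[of "{C}" X "\<lambda>_. 1"] that by simp
  qed
  have fin: "U (r F) D = (\<Sum>C\<in>F. f C * T C D)" if "finite F" "F \<subseteq> X" for F
    using that
  proof (induction F rule: finite_induct)
    case empty
    have "U (\<lambda>x. 0 * f x + 0 * f x) = (\<lambda>x. 0 * U f x + 0 * U f x)" by (rule lin'[OF f f])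
    then show ?case by (simp add: r_def)
  next
    case (insert C F)
    have e: "r (insert C F) = (\<lambda>x. f C * ket C x + 1 * r F x)"
      using insert.hyps by (auto simp: r_def ket_def)
    have "U (r (insert C F)) = (\<lambda>x. f C * U (ket C) x + 1 * U (r F) x)"
      unfolding e by (rule lin') (use insert rl kl in auto)
    then show ?case using insert basis by simp
  qed
  have sumf: "(\<lambda>x. (cmod (f x))\<^sup>2) summable_on X" using f by (simp add: ell2_def)
  have err: "cmod (U (r F) D - U f D) \<le> \<bar>K\<bar> * sqrt (s - (\<Sum>x\<in>F. (cmod (f x))\<^sup>2))"
    if "finite F" "F \<subseteq> X" for F
  proof -
    define g where "g = (\<lambda>x. 1 * r F x + (-1) * f x)"
    have Ug: "U g = (\<lambda>x. 1 * U (r F) x + (-1) * U f x)"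
      unfolding g_def by (rule lin'[OF rl[OF that] f])
    have sF: "(\<lambda>x. (cmod (f x))\<^sup>2) summable_on F" using that by simp
    have tail: "(\<lambda>x. (cmod (f x))\<^sup>2) summable_on (X - F)"
      by (rule summable_on_subset_banach[OF sumf]) auto
    have "(\<lambda>x. (cmod (g x))\<^sup>2) summable_on X \<longleftrightarrow> (\<lambda>x. (cmod (f x))\<^sup>2) summable_on (X - F)"
      by (rule summable_on_cong_neutral) (auto simp: g_def r_def)
    then have gl: "g \<in> ell2 X"
      using f that tail by (auto simp: ell2_def g_def r_def)
    have "(\<Sum>\<^sub>\<infinity>x\<in>X. (cmod (g x))\<^sup>2) = (\<Sum>\<^sub>\<infinity>x\<in>X - F. (cmod (f x))\<^sup>2)"
      by (rule infsum_cong_neutral) (auto simp: g_def r_def)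
    also have "\<dots> = s - (\<Sum>x\<in>F. (cmod (f x))\<^sup>2)"
      unfolding s_def using infsum_Diff[OF sumf sF that(2)] that(1) by simp
    finally have n: "ell2_norm X g = sqrt (s - (\<Sum>x\<in>F. (cmod (f x))\<^sup>2))"
      by (simp add: ell2_norm_def)
    have "cmod (U g D) \<le> ell2_norm X (U g)"
      by (rule cmod_le_ell2_norm) (use lin gl in \<open>auto simp: linear_on_ell2_def\<close>)
    also have "\<dots> \<le> K * ell2_norm X g" by (rule bdd[OF gl])
    also have "\<dots> \<le> \<bar>K\<bar> * ell2_norm X g"
      by (rule mult_right_mono) (auto simp: ell2_norm_def infsum_nonneg)
    finally show ?thesis by (simp add: Ug n)
  qed
  have "((\<lambda>F. \<Sum>x\<in>F. (cmod (f x))\<^sup>2) \<longlongrightarrow> s) (finite_subsets_at_top X)"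
    unfolding s_def using has_sum_infsum[OF sumf] by (simp add: has_sum_def)
  then have "((\<lambda>F. \<bar>K\<bar> * sqrt (s - (\<Sum>x\<in>F. (cmod (f x))\<^sup>2))) \<longlongrightarrow> \<bar>K\<bar> * sqrt (s - s))
      (finite_subsets_at_top X)"
    by (intro tendsto_intros)
  then have z: "((\<lambda>F. \<bar>K\<bar> * sqrt (s - (\<Sum>x\<in>F. (cmod (f x))\<^sup>2))) \<longlongrightarrow> 0)
      (finite_subsets_at_top X)" by simp
  have "((\<lambda>F. U (r F) D - U f D) \<longlongrightarrow> 0) (finite_subsets_at_top X)"
    by (rule Lim_null_comparison[OF _ z]) (auto intro!: eventually_finite_subsets_at_top_weakI err)
  then have "((\<lambda>F. U (r F) D) \<longlongrightarrow> U f D) (finite_subsets_at_top X)"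
    by (simp add: LIM_zero_iff)
  then have "((\<lambda>F. \<Sum>C\<in>F. f C * T C D) \<longlongrightarrow> U f D) (finite_subsets_at_top X)"
    by (rule Lim_transform_eventually)
       (auto intro!: eventually_finite_subsets_at_top_weakI fin)
  then have "((\<lambda>C. f C * T C D) has_sum U f D) X"
    by (simp add: has_sum_def)
  then show "U f D = lin_ext X T f D"
    by (simp add: lin_ext_def infsumI)
qed


section \<open>Tapes and plain configurations\<close>

class tape_alphabet = finite +
  fixes blank :: 'a
    and tape_one :: 'a
  assumes blank_neq_tape_one: "blank \<noteq> tape_one"

datatype dir = L | R

definition same_up_to_blanks ::
    "'s::tape_alphabet list \<times> 'q \<times> 's list \<Rightarrow> 's list \<times> 'q \<times> 's list \<Rightarrow> bool" where
  "same_up_to_blanks = (\<lambda>(\<alpha>, q, \<beta>) (\<alpha>', q', \<beta>').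
     (\<exists>m n. replicate m blank @ \<alpha> = replicate n blank @ \<alpha>') \<and>
     q = q' \<and>
     (\<exists>m n. \<beta> @ replicate m blank = \<beta>' @ replicate n blank))"

lemma equivp_same_up_to_blanks:
  "equivp (same_up_to_blanks :: 's::tape_alphabet list \<times> 'q \<times> 's list \<Rightarrow> _)"
proof (rule equivpI)
  show "reflp (same_up_to_blanks :: 's list \<times> 'q \<times> 's list \<Rightarrow> _)"
    by (auto simp: reflp_def same_up_to_blanks_def)
  show "symp (same_up_to_blanks :: 's list \<times> 'q \<times> 's list \<Rightarrow> _)"
    unfolding symp_def same_up_to_blanks_def by (auto; metis)
  have l: "\<exists>m n. replicate m blank @ a = replicate n blank @ (c::'s list)"
    if "replicate i blank @ a = replicate j blank @ b"
       "replicate k blank @ b = replicate l blank @ c" for a b c :: "'s list" and i j k l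
  proof -
    have "replicate (k + i) blank @ a = replicate (k + j) blank @ b"
      using that(1) by (simp add: replicate_add)
    also have "\<dots> = replicate j blank @ (replicate k blank @ b)"
      by (simp add: replicate_add[symmetric] add.commute flip: append_assoc)
    also have "\<dots> = replicate (j + l) blank @ c"
      using that(2) by (simp add: replicate_add)
    finally show ?thesis by blast
  qed
  have r: "\<exists>m n. a @ replicate m blank = (c::'s list) @ replicate n blank"
    if "a @ replicate i blank = b @ replicate j blank"
       "b @ replicate k blank = c @ replicate l blank" for a b c :: "'s list" and i j k l
  proof -
    have "a @ replicate (i + k) blank = (b @ replicate j blank) @ replicate k blank"
      using that(1) by (simp add: replicate_add flip: append_assoc)
    also have "\<dots> = (b @ replicate k blank) @ replicate j blank"
      by (simp add: replicate_add[symmetric] add.commute)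
    also have "\<dots> = c @ replicate (l + j) blank"
      using that(2) by (simp add: replicate_add)
    finally show ?thesis by blast
  qed
  show "transp (same_up_to_blanks :: 's list \<times> 'q \<times> 's list \<Rightarrow> _)"
    unfolding transp_def same_up_to_blanks_def using l r by (clarsimp; blast)
qed

quotient_type (overloaded) ('s, 'q) plain_conf =
    "'s::tape_alphabet list \<times> 'q \<times> 's list" / same_up_to_blanks
  by (rule equivp_same_up_to_blanks)

text \<open>\<open>plain \<alpha> q \<beta>\<close> is the plain configuration \<open>\<langle>\<alpha>, q, \<beta>\<rangle>\<close>.\<close>

lift_definition plain :: "'s::tape_alphabet list \<Rightarrow> 'q \<Rightarrow> 's list \<Rightarrow> ('s, 'q) plain_conf"
  is "\<lambda>\<alpha> q \<beta>. (\<alpha>, q, \<beta>)" .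

lift_definition state_of :: "('s::tape_alphabet, 'q) plain_conf \<Rightarrow> 'q"
  is "\<lambda>(\<alpha>, q, \<beta>). q"
  by (auto simp: same_up_to_blanks_def)

fun first_symbol :: "'s::tape_alphabet list \<Rightarrow> 's" where
  "first_symbol [] = blank"
| "first_symbol (u # \<beta>) = u"

fun last_symbol :: "'s::tape_alphabet list \<Rightarrow> 's" where
  "last_symbol \<alpha> = (if \<alpha> = [] then blank else last \<alpha>)"

lemma first_symbol_append_blanks: "first_symbol (\<beta> @ replicate n blank) = first_symbol \<beta>"
  by (cases \<beta>; cases n) auto

lemma last_symbol_append_blanks: "last_symbol (replicate n blank @ \<alpha>) = last_symbol \<alpha>"
  by (cases n) (auto simp: last_append simp flip: replicate_append_same)

lemma tl_append_blanks: "\<exists>m. tl (\<beta> @ replicate n blank) = tl \<beta> @ replicate m blank"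
proof (cases "\<beta> = []")
  case True
  then have "tl (\<beta> @ replicate n blank) = tl \<beta> @ replicate (n - 1) blank" by (cases n) auto
  then show ?thesis by blast
next
  case False
  then show ?thesis by auto
qed

lemma butlast_append_blanks:
  "\<exists>m. butlast (replicate n blank @ \<alpha>) = replicate m blank @ butlast \<alpha>"
proof (cases "\<alpha> = []")
  case True
  then have "butlast (replicate n blank @ \<alpha>) = replicate (n - 1) blank @ butlast \<alpha>"
    by (cases n) (auto simp flip: replicate_append_same)
  then show ?thesis by blast
next
  case False
  then show ?thesis by (auto simp: butlast_append)
qed

lift_definition current_symbol :: "('s::tape_alphabet, 'q) plain_conf \<Rightarrow> 's"
  is "\<lambda>(\<alpha>, q, \<beta>). first_symbol \<beta>"
  by (auto simp: same_up_to_blanks_def; metis first_symbol_append_blanks)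

text \<open>\<open>successor C p v d\<close> is \<open>C\<^bsub>p,v,d\<^esub>\<close>.\<close>

lift_definition successor ::
    "('s::tape_alphabet, 'q) plain_conf \<Rightarrow> 'q \<Rightarrow> 's \<Rightarrow> dir \<Rightarrow> ('s, 'q) plain_conf"
  is "\<lambda>(\<alpha>, q, \<beta>) p v d.
        (case d of
           R \<Rightarrow> (\<alpha> @ [v], p, tl \<beta>)
         | L \<Rightarrow> (butlast \<alpha>, p, last_symbol \<alpha> # v # tl \<beta>))"
proof -
  fix x y :: "'s list \<times> 'q \<times> 's list" and p :: 'q and v :: 's and d
  obtain \<alpha> q \<beta> where x: "x = (\<alpha>, q, \<beta>)" by (cases x)
  obtain \<alpha>' q' \<beta>' where y: "y = (\<alpha>', q', \<beta>')" by (cases y)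
  assume "same_up_to_blanks x y"
  then obtain i j k l where
      a: "replicate i blank @ \<alpha> = replicate j blank @ \<alpha>'"
      and b: "\<beta> @ replicate k blank = \<beta>' @ replicate l blank"
    by (auto simp: same_up_to_blanks_def x y)
  have tl: "\<exists>m n. tl \<beta> @ replicate m blank = tl \<beta>' @ replicate n blank"
    using tl_append_blanks[of \<beta> k] tl_append_blanks[of \<beta>' l] b by metis
  have bl: "\<exists>m n. replicate m blank @ butlast \<alpha> = replicate n blank @ butlast \<alpha>'"
    using butlast_append_blanks[of i \<alpha>] butlast_append_blanks[of j \<alpha>'] a by metis
  have ls: "last_symbol \<alpha> = last_symbol \<alpha>'"
    using last_symbol_append_blanks[of i \<alpha>] last_symbol_append_blanks[of j \<alpha>'] a by metis
  have av: "\<exists>m n. replicate m blank @ \<alpha> @ [v] = replicate n blank @ \<alpha>' @ [v]"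
    using a by (metis append_assoc)
  show "same_up_to_blanks
     ((case x of (\<alpha>, q, \<beta>) \<Rightarrow> \<lambda>p v d. case d of R \<Rightarrow> (\<alpha> @ [v], p, tl \<beta>)
         | L \<Rightarrow> (butlast \<alpha>, p, last_symbol \<alpha> # v # tl \<beta>)) p v d)
     ((case y of (\<alpha>, q, \<beta>) \<Rightarrow> \<lambda>p v d. case d of R \<Rightarrow> (\<alpha> @ [v], p, tl \<beta>)
         | L \<Rightarrow> (butlast \<alpha>, p, last_symbol \<alpha> # v # tl \<beta>)) p v d)"
    using tl bl ls av by (cases d) (auto simp: x y same_up_to_blanks_def simp del: last_symbol.simps)
qed


section \<open>Bernstein--Vazirani QTMs\<close>

text \<open>
  The alphabet is the type \<open>'s\<close> and the states form a finite subset of the type \<open>'q\<close>, which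
  serves as a supply of state names.
  Transition functions are total in HOL; all definitions below consult them only on the domains
  prescribed by the set of states.  As these domains are finite, every complex-valued function on
  them is in \<open>\<ell>\<^sup>2\<close>.
\<close>

record ('s, 'q) bv_machine =
  bv_states :: "'q set"
  bv_delta :: "'q \<Rightarrow> 's \<Rightarrow> 'q \<times> 's \<times> dir \<Rightarrow> complex"
  bv_init :: 'q
  bv_final :: 'q

definition bv_confs :: "('s::tape_alphabet, 'q) bv_machine \<Rightarrow> ('s, 'q) plain_conf set" where
  "bv_confs M = {C. state_of C \<in> bv_states M}"

definition bv_step ::
    "('s::tape_alphabet, 'q) bv_machine \<Rightarrow> ('s, 'q) plain_conf \<Rightarrow> ('s, 'q) plain_conf \<Rightarrow> complex" where
  "bv_step M C = (\<lambda>D.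
     \<Sum>(p, v, d) \<in> bv_states M \<times> UNIV \<times> {L, R}.
       bv_delta M (state_of C) (current_symbol C) (p, v, d) * ket (successor C p v d) D)"

definition bv_evolution ::
    "('s::tape_alphabet, 'q) bv_machine \<Rightarrow>
     (('s, 'q) plain_conf \<Rightarrow> complex) \<Rightarrow> ('s, 'q) plain_conf \<Rightarrow> complex" where
  "bv_evolution M = lin_ext (bv_confs M) (bv_step M)"

definition is_bv_qtm :: "('s::tape_alphabet, 'q) bv_machine \<Rightarrow> bool" where
  "is_bv_qtm M \<longleftrightarrow>
     finite (bv_states M) \<and> bv_init M \<in> bv_states M \<and> bv_final M \<in> bv_states M \<and>
     unitary_on_ell2 (bv_confs M) (bv_evolution M) \<and>
     (\<forall>a. bv_delta M (bv_final M) a (bv_init M, a, R) = 1) \<and>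
     (\<forall>a. \<forall>q'\<in>bv_states M. \<forall>a' d. (q', a', d) \<noteq> (bv_init M, a, R) \<longrightarrow>
        bv_delta M (bv_final M) a (q', a', d) = 0) \<and>
     (\<forall>q'\<in>bv_states M. \<forall>a' a d. (q', a', d) \<noteq> (bv_final M, a, R) \<longrightarrow>
        bv_delta M q' a' (bv_init M, a, d) = 0)"

definition bv_halts_in ::
    "('s::tape_alphabet, 'q) bv_machine \<Rightarrow> nat \<Rightarrow> ('s, 'q) plain_conf \<Rightarrow> bool" where
  "bv_halts_in M k C \<longleftrightarrow>
     (\<forall>D. (bv_evolution M ^^ k) (ket C) D \<noteq> 0 \<longrightarrow> state_of D = bv_final M) \<and>
     (\<forall>i<k. \<forall>D. (bv_evolution M ^^ i) (ket C) D \<noteq> 0 \<longrightarrow> state_of D \<noteq> bv_final M)"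


section \<open>QTMs with source and target states\<close>

record ('s, 'q) qtm_machine =
  states :: "'q set"
  sources :: "'q set"
  targets :: "'q set"
  delta0 :: "'q \<Rightarrow> 's \<Rightarrow> 'q \<times> 's \<times> dir \<Rightarrow> complex"
  init :: 'q
  final :: 'q

text \<open>
  Source and target states are disjoint: for a state in both sets and a counter \<open>n > 0\<close> the evolution
  would be required both to decrease and to increase the counter.
\<close>

definition is_pre_qtm :: "('s::tape_alphabet, 'q) qtm_machine \<Rightarrow> bool" where
  "is_pre_qtm M \<longleftrightarrow>
     finite (states M) \<and> sources M \<subseteq> states M \<and> targets M \<subseteq> states M \<and>
     sources M \<inter> targets M = {} \<and> init M \<in> sources M \<and> final M \<in> targets M"

type_synonym ('s, 'q) conf = "('s, 'q) plain_conf \<times> nat"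

definition confs :: "('s::tape_alphabet, 'q) qtm_machine \<Rightarrow> ('s, 'q) conf set" where
  "confs M = {(C, n). state_of C \<in> states M \<and>
                      (state_of C \<notin> sources M \<union> targets M \<longrightarrow> n = 0)}"

definition step ::
    "('s::tape_alphabet, 'q) qtm_machine \<Rightarrow> ('s, 'q) conf \<Rightarrow> ('s, 'q) conf \<Rightarrow> complex" where
  "step M = (\<lambda>(C, n).
     if state_of C \<in> targets M then ket (C, n + 1)
     else if state_of C \<in> sources M \<and> n > 0 then ket (C, n - 1)
     else (\<lambda>D. \<Sum>(p, v, d) \<in> (states M - sources M) \<times> UNIV \<times> {L, R}.
                 delta0 M (state_of C) (current_symbol C) (p, v, d) * ket (successor C p v d, 0) D))"

definition evolution ::
    "('s::tape_alphabet, 'q) qtm_machine \<Rightarrow>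
     (('s, 'q) conf \<Rightarrow> complex) \<Rightarrow> ('s, 'q) conf \<Rightarrow> complex" where
  "evolution M = lin_ext (confs M) (step M)"

definition is_qtm :: "('s::tape_alphabet, 'q) qtm_machine \<Rightarrow> bool" where
  "is_qtm M \<longleftrightarrow> is_pre_qtm M \<and> unitary_on_ell2 (confs M) (evolution M)"

text \<open>The identification of \<open>\<langle>\<alpha>, q, \<beta>\<rangle>\<close> with \<open>\<langle>\<alpha>, q, \<beta>, 0\<rangle>\<close>, extended to superpositions.\<close>

definition with_counter_zero ::
    "(('s::tape_alphabet, 'q) plain_conf \<Rightarrow> complex) \<Rightarrow> ('s, 'q) conf \<Rightarrow> complex" where
  "with_counter_zero \<phi> = (\<lambda>(C, n). if n = 0 then \<phi> C else 0)"

end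

theory Submission
  imports Defs
begin

text \<open>
  If \<open>q\<^sub>0 \<noteq> q\<^sub>f\<close>, keep \<open>M\<close> and make \<open>q\<^sub>0\<close> the only source and \<open>q\<^sub>f\<close> the only target.
  The evolution of \<open>M\<close> carries the configurations in \<open>q\<^sub>f\<close> bijectively onto those in \<open>q\<^sub>0\<close>, so
  replacing these transitions by counter steps amounts to composing a unitary operator with a
  permutation of the configurations. Both machines agree as long as \<open>q\<^sub>f\<close> does not occur.
\<close>

section \<open>Unitary operators on square-summable families\<close>

text \<open>Comparison with the sum of the squared moduli gives absolute summability; this allows
  inner products to be split over a partition of the index set.\<close>

lemma ell2_mult_summable:
  assumes "f \<in> ell2 X" "g \<in> ell2 X"
  shows "(\<lambda>x. cnj (f x) * g x) summable_on X"
proof (rule abs_summable_summable, rule Infinite_Sum.abs_summable_on_comparison_test')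
  show "(\<lambda>x. (cmod (f x))\<^sup>2 + (cmod (g x))\<^sup>2) summable_on X"
    using assms by (intro summable_on_add) (auto simp: ell2_def)
  show "norm (cnj (f x) * g x) \<le> (cmod (f x))\<^sup>2 + (cmod (g x))\<^sup>2" for x
  proof -
    have "0 \<le> cmod (f x) * cmod (g x)" by simp
    then show ?thesis
      using sum_squares_bound[of "cmod (f x)" "cmod (g x)"]
      unfolding norm_mult complex_mod_cnj by linarith
  qed
qed

lemma unitary_on_ell2_comp:
  assumes U: "unitary_on_ell2 X U" and V: "unitary_on_ell2 X V"
  shows "unitary_on_ell2 X (\<lambda>f. V (U f))"
proof -
  have "(\<lambda>f. V (U f)) ` ell2 X = V ` (U ` ell2 X)" by (simp add: image_image)
  then show ?thesis
    using U V by (simp add: unitary_on_ell2_def linear_on_ell2_def)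
qed

text \<open>Reindexing along \<open>\<pi>\<close> preserves all sums over \<open>X\<close>, and
  pulling back along the inverse gives preimages. Coordinates are pulled back, so
  \<open>ket c\<close> with \<open>c\<close> in \<open>X\<close> goes to the ket at the inverse
  image of \<open>c\<close>. The value 0 outside \<open>X\<close> is what membership in
  \<open>ell2 X\<close> demands.\<close>

lemma unitary_on_ell2_permute:
  assumes bij: "bij_betw \<pi> X X"
  shows "unitary_on_ell2 X (\<lambda>f x. if x \<in> X then f (\<pi> x) else 0)" (is "unitary_on_ell2 X ?P")
proof -
  have perm: "(\<lambda>x. if x \<in> X then f (\<rho> x) else 0) \<in> ell2 X"
    if "f \<in> ell2 X" "bij_betw \<rho> X X" for f \<rho>
  proof -
    have "(\<lambda>x. (cmod (f (\<rho> x)))\<^sup>2) summable_on X"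
      using summable_on_reindex_bij_betw[OF that(2), of "\<lambda>x. (cmod (f x))\<^sup>2"] that(1)
      by (simp add: ell2_def)
    then have "(\<lambda>x. (cmod (if x \<in> X then f (\<rho> x) else 0))\<^sup>2) summable_on X"
      by (simp cong: summable_on_cong)
    then show ?thesis by (simp add: ell2_def)
  qed
  have inner: "ell2_inner X (?P f) (?P g) = ell2_inner X f g" for f g
  proof -
    have "ell2_inner X (?P f) (?P g) = (\<Sum>\<^sub>\<infinity>x\<in>X. cnj (f (\<pi> x)) * g (\<pi> x))"
      unfolding ell2_inner_def by (rule infsum_cong) simp
    also have "\<dots> = ell2_inner X f g"
      unfolding ell2_inner_def
      using infsum_reindex_bij_betw[OF bij, of "\<lambda>x. cnj (f x) * g x"] .
    finally show ?thesis .
  qed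
  have surj: "g \<in> ?P ` ell2 X" if g: "g \<in> ell2 X" for g
  proof
    have inv: "bij_betw (inv_into X \<pi>) X X" by (rule bij_betw_inv_into[OF bij])
    show "(\<lambda>x. if x \<in> X then g (inv_into X \<pi> x) else 0) \<in> ell2 X"
      by (rule perm[OF g inv])
    show "g = ?P (\<lambda>x. if x \<in> X then g (inv_into X \<pi> x) else 0)"
      using g bij by (auto simp: ell2_def bij_betw_inv_into_left bij_betwE fun_eq_iff)
  qed
  show ?thesis
    using perm[OF _ bij] inner surj
    by (auto simp: unitary_on_ell2_def linear_on_ell2_def fun_eq_iff)
qed

lemma infsum_single:
  assumes "\<And>x. x \<in> X \<Longrightarrow> x \<noteq> a \<Longrightarrow> h x = 0" "a \<in> X"
  shows "infsum h X = h a"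
proof -
  have "infsum h X = infsum h {a}" by (rule infsum_cong_neutral) (use assms in auto)
  then show ?thesis by simp
qed

text \<open>Pushing basis vectors forward by \<open>\<sigma>\<close> pulls coordinates back by its
  inverse \<open>\<pi>\<close>: at coordinate \<open>y\<close> only the summand at
  \<open>\<pi> y\<close> survives.\<close>

lemma lin_ext_permute:
  assumes bij: "bij_betw \<pi> X X" "\<And>x. x \<in> X \<Longrightarrow> \<sigma> (\<pi> x) = x"
    and \<sigma>: "\<And>x. x \<in> X \<Longrightarrow> \<sigma> x \<in> X" "\<And>x. x \<in> X \<Longrightarrow> \<pi> (\<sigma> x) = x"
    and T: "\<And>x. x \<in> X \<Longrightarrow> T x = ket (\<sigma> x)"
  shows "lin_ext X T f = (\<lambda>x. if x \<in> X then f (\<pi> x) else 0)"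
proof
  fix y
  show "lin_ext X T f y = (if y \<in> X then f (\<pi> y) else 0)"
  proof (cases "y \<in> X")
    case True
    then have "\<pi> y \<in> X" using bij(1) by (auto dest: bij_betwE)
    moreover have "x \<noteq> \<pi> y \<Longrightarrow> \<sigma> x \<noteq> y" if "x \<in> X" for x using that \<sigma>(2) by auto
    ultimately have "lin_ext X T f y = f (\<pi> y) * T (\<pi> y) y"
      unfolding lin_ext_def by (intro infsum_single) (auto simp: T ket_def)
    then show ?thesis using True \<open>\<pi> y \<in> X\<close> by (simp add: T bij(2) ket_def)
  next
    case False
    then have "f x * T x y = 0" if "x \<in> X" for x
      using that \<sigma>(1)[OF that] by (auto simp: T ket_def)
    then have "(\<Sum>\<^sub>\<infinity>x\<in>X. f x * T x y) = 0" by (intro infsum_0)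
    then show ?thesis using False by (simp add: lin_ext_def)
  qed
qed

section \<open>Extending an operator by the identity on positive counters\<close>

lemma summable_on_counter_split:
  fixes h :: "'c \<times> nat \<Rightarrow> 'b::banach"
  assumes "\<And>x. (x, 0) \<in> Y \<longleftrightarrow> x \<in> X"
  shows "h summable_on Y \<longleftrightarrow>
    (\<lambda>x. h (x, 0)) summable_on X \<and> h summable_on {y \<in> Y. snd y \<noteq> 0}"
proof -
  have Y: "Y = (\<lambda>x. (x, 0)) ` X \<union> {y \<in> Y. snd y \<noteq> 0}" using assms by auto
  have "h summable_on (\<lambda>x. (x, 0)) ` X \<longleftrightarrow> (\<lambda>x. h (x, 0)) summable_on X"
    by (subst summable_on_reindex) (auto simp: inj_on_def o_def)
  moreover have "h summable_on (\<lambda>x. (x, 0)) ` X \<and> h summable_on {y \<in> Y. snd y \<noteq> 0}"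
    if "h summable_on Y"
    using that assms by (auto intro!: summable_on_subset_banach[OF that])
  moreover have "h summable_on Y"
    if "h summable_on (\<lambda>x. (x, 0)) ` X" "h summable_on {y \<in> Y. snd y \<noteq> 0}"
    by (subst Y, rule summable_on_Un_disjoint) (use that in auto)
  ultimately show ?thesis by blast
qed

lemma infsum_counter_split:
  fixes h :: "'c \<times> nat \<Rightarrow> 'b::banach"
  assumes XY: "\<And>x. (x, 0) \<in> Y \<longleftrightarrow> x \<in> X" and "h summable_on Y"
  shows "infsum h Y = (\<Sum>\<^sub>\<infinity>x\<in>X. h (x, 0)) + infsum h {y \<in> Y. snd y \<noteq> 0}"
proof -
  have Y: "Y = (\<lambda>x. (x, 0)) ` X \<union> {y \<in> Y. snd y \<noteq> 0}" using XY by auto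
  have i: "inj_on (\<lambda>x. (x, 0::nat)) X" by (auto simp: inj_on_def)
  have s: "(\<lambda>x. h (x, 0)) summable_on X" "h summable_on {y \<in> Y. snd y \<noteq> 0}"
    using summable_on_counter_split[OF XY, of h] assms by auto
  have "infsum h Y = infsum h ((\<lambda>x. (x, 0)) ` X) + infsum h {y \<in> Y. snd y \<noteq> 0}"
    by (subst Y, rule infsum_Un_disjoint) (use s in \<open>auto simp: summable_on_reindex[OF i] o_def\<close>)
  then show ?thesis by (simp add: infsum_reindex[OF i] o_def)
qed

lemma ell2_counter_split:
  assumes "\<And>x. (x, 0) \<in> Y \<longleftrightarrow> x \<in> X"
  shows "f \<in> ell2 Y \<longleftrightarrow> (\<lambda>x. f (x, 0)) \<in> ell2 X \<and> (\<forall>y. y \<notin> Y \<longrightarrow> f y = 0) \<and>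
    (\<lambda>y. (cmod (f y))\<^sup>2) summable_on {y \<in> Y. snd y \<noteq> (0::nat)}"
  using assms by (auto simp: ell2_def summable_on_counter_split[OF assms])

text \<open>The direct sum of \<open>U\<close> on the slice with counter zero and the identity on
  the positive counters.\<close>

definition on_counter_zero ::
    "(('c \<Rightarrow> complex) \<Rightarrow> 'c \<Rightarrow> complex) \<Rightarrow> ('c \<times> nat \<Rightarrow> complex) \<Rightarrow> 'c \<times> nat \<Rightarrow> complex" where
  "on_counter_zero U f = (\<lambda>(x, n). if n = 0 then U (\<lambda>x. f (x, 0)) x else f (x, n))"

lemma on_counter_zero_simps:
  "on_counter_zero U f (x, 0) = U (\<lambda>x. f (x, 0)) x"
  "snd y \<noteq> 0 \<Longrightarrow> on_counter_zero U f y = f y"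
  by (auto simp: on_counter_zero_def split: prod.splits)

text \<open>\<open>ell2 Y\<close> is the orthogonal sum of a copy of \<open>ell2 X\<close> and the
  part with positive counters, and both summands of the operator are unitary.\<close>

lemma unitary_on_counter_zero:
  fixes Y :: "('c \<times> nat) set"
  assumes XY: "\<And>x. (x, 0) \<in> Y \<longleftrightarrow> x \<in> X" and U: "unitary_on_ell2 X U"
  shows "unitary_on_ell2 Y (on_counter_zero U)"
proof -
  let ?W = "on_counter_zero U"
  let ?Z = "{y \<in> Y. snd y \<noteq> 0}"
  note split = ell2_counter_split[of Y X, OF XY]
  \<comment> \<open>Stated for an arbitrary map \<open>V\<close>, linear or not, because
    surjectivity below applies it to a constant one.\<close>
  have lift: "on_counter_zero V f \<in> ell2 Y"
    if f: "f \<in> ell2 Y" and V: "\<And>g. g \<in> ell2 X \<Longrightarrow> V g \<in> ell2 X" for V f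
  proof -
    have 0: "V (\<lambda>x. f (x, 0)) \<in> ell2 X" using f V by (simp add: split)
    have "(\<lambda>y. (cmod (on_counter_zero V f y))\<^sup>2) summable_on ?Z"
      by (subst summable_on_cong[of _ _ "\<lambda>y. (cmod (f y))\<^sup>2"])
         (use f in \<open>auto simp: split on_counter_zero_simps\<close>)
    moreover have "on_counter_zero V f y = 0" if "y \<notin> Y" for y
      using that 0 f XY by (cases y; cases "snd y = 0")
        (auto simp: split on_counter_zero_def ell2_def)
    ultimately show ?thesis using 0 by (simp add: split on_counter_zero_simps)
  qed
  have Ulin: "\<And>f. f \<in> ell2 X \<Longrightarrow> U f \<in> ell2 X"
    "\<And>f g a b. f \<in> ell2 X \<Longrightarrow> g \<in> ell2 X \<Longrightarrow>
       U (\<lambda>x. a * f x + b * g x) = (\<lambda>x. a * U f x + b * U g x)"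
    using U by (auto simp: unitary_on_ell2_def linear_on_ell2_def)
  have "?W (\<lambda>x. a * f x + b * g x) = (\<lambda>x. a * ?W f x + b * ?W g x)"
    if "f \<in> ell2 Y" "g \<in> ell2 Y" for f g a b
    using that by (auto simp: split on_counter_zero_def Ulin)
  moreover have "ell2_inner Y (?W f) (?W g) = ell2_inner Y f g"
    if f: "f \<in> ell2 Y" and g: "g \<in> ell2 Y" for f g
  proof -
    have inner: "ell2_inner Y f g =
        ell2_inner X (\<lambda>x. f (x, 0)) (\<lambda>x. g (x, 0)) + ell2_inner ?Z f g"
      if "f \<in> ell2 Y" "g \<in> ell2 Y" for f g
      unfolding ell2_inner_def
      using infsum_counter_split[OF XY ell2_mult_summable[OF that]] .
    have "ell2_inner ?Z (?W f) (?W g) = ell2_inner ?Z f g"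
      unfolding ell2_inner_def by (rule infsum_cong) (simp add: on_counter_zero_simps)
    moreover have "(\<lambda>x. f (x, 0)) \<in> ell2 X" "(\<lambda>x. g (x, 0)) \<in> ell2 X"
      using f g by (auto simp: split)
    ultimately show ?thesis
      using U inner[OF lift[OF f Ulin(1)] lift[OF g Ulin(1)]] inner[OF f g]
      by (simp add: on_counter_zero_simps(1) unitary_on_ell2_def)
  qed
  moreover have "g \<in> ?W ` ell2 Y" if g: "g \<in> ell2 Y" for g
  proof -
    have "(\<lambda>x. g (x, 0)) \<in> U ` ell2 X"
      using U g by (simp add: unitary_on_ell2_def split)
    then obtain f0 where f0: "(\<lambda>x. g (x, 0)) = U f0" "f0 \<in> ell2 X"
      by (rule imageE)
    \<comment> \<open>The constant map replaces the slice of \<open>g\<close> at counter zero by the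
      preimage \<open>f0\<close> and keeps the rest.\<close>
    have "on_counter_zero (\<lambda>_. f0) g \<in> ell2 Y" by (rule lift[OF g]) (rule f0(2))
    moreover have "g = ?W (on_counter_zero (\<lambda>_. f0) g)"
      using fun_cong[OF f0(1)] by (auto simp: on_counter_zero_def)
    ultimately show ?thesis by (intro rev_image_eqI)
  qed
  moreover have "?W f \<in> ell2 Y" if "f \<in> ell2 Y" for f
    using that Ulin(1) by (rule lift)
  ultimately show ?thesis
    unfolding unitary_on_ell2_def linear_on_ell2_def by (simp add: subset_antisym image_subsetI subsetI)
qed


section \<open>Moving the head without changing the tape\<close>

text \<open>The transition prescribed at \<open>q\<^sub>f\<close> is of this kind. Since the tape is
  preserved, it can be undone by a move in the opposite direction.\<close>

definition move :: "('s::tape_alphabet, 'q) plain_conf \<Rightarrow> 'q \<Rightarrow> dir \<Rightarrow> ('s, 'q) plain_conf" where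
  "move C p d = successor C p (current_symbol C) d"

lemma state_of_plain [simp]: "state_of (plain \<alpha> q \<beta>) = q"
  by transfer simp

lemma state_of_successor [simp]: "state_of (successor C p v d) = p"
  by transfer (auto split: dir.splits)

lemma state_of_move [simp]: "state_of (move C p d) = p"
  by (simp add: move_def)

lemma same_up_to_blanksI:
  assumes "replicate i blank @ a = replicate j blank @ a'"
    and "b @ replicate k blank = b' @ replicate l blank"
  shows "same_up_to_blanks (a, q, b) (a', q, b')"
  using assms by (auto simp: same_up_to_blanks_def)

text \<open>On representatives the two moves can leave extra blanks on the right: two if
  \<open>b\<close> is empty, one if \<open>b\<close> is a single symbol. Hence the equation holds
  only in the quotient.\<close>

lemma move_R_L:
  fixes C :: "('s::tape_alphabet, 'q) plain_conf"
  shows "state_of C = q \<Longrightarrow> move (move C p R) q L = C"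
  unfolding move_def
proof (transfer, clarsimp simp del: last_symbol.simps)
  fix a :: "'s list" and b q
  show "same_up_to_blanks
         (a, q, last_symbol (a @ [first_symbol b]) # first_symbol (tl b) # tl (tl b)) (a, q, b)"
  proof (cases b)
    case Nil
    then show ?thesis
      by (intro same_up_to_blanksI[of 0 _ 0 _ _ 0 _ 2]) (auto simp: numeral_2_eq_2)
  next
    case (Cons x c)
    show ?thesis
    proof (cases c)
      case Nil
      then show ?thesis
        using Cons by (intro same_up_to_blanksI[of 0 _ 0 _ _ 0 _ 1]) auto
    next
      case (Cons y d)
      then show ?thesis
        using \<open>b = x # c\<close> by (intro same_up_to_blanksI[of 0 _ 0 _ _ 0 _ 0]) auto
    qed
  qed
qed

lemma move_L_R:
  fixes C :: "('s::tape_alphabet, 'q) plain_conf"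
  shows "state_of C = q \<Longrightarrow> move (move C p L) q R = C"
  unfolding move_def
proof (transfer, clarsimp simp del: last_symbol.simps)
  fix a :: "'s list" and b q
  show "same_up_to_blanks
         (butlast a @ [last_symbol a], q, first_symbol b # tl b) (a, q, b)"
    by (cases "a = []"; cases b)
       (auto intro: same_up_to_blanksI[of 0 _ 1 _ _ 0 _ 1] same_up_to_blanksI[of 0 _ 1 _ _ 0 _ 0]
         same_up_to_blanksI[of 0 _ 0 _ _ 0 _ 1] same_up_to_blanksI[of 0 _ 0 _ _ 0 _ 0])
qed


section \<open>The machine with counters\<close>

text \<open>\<open>step\<close> consults \<open>delta0\<close> only from states other than
  \<open>q\<^sub>f\<close> and only towards states other than \<open>q\<^sub>0\<close>, so the whole
  \<open>bv_delta M\<close> can be passed on.\<close>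

definition qtm_of_bv :: "('s, 'q) bv_machine \<Rightarrow> ('s, 'q) qtm_machine" where
  "qtm_of_bv M = \<lparr>states = bv_states M, sources = {bv_init M}, targets = {bv_final M},
     delta0 = bv_delta M, init = bv_init M, final = bv_final M\<rparr>"

lemma confs_qtm_of_bv:
  "(C, n) \<in> confs (qtm_of_bv M) \<longleftrightarrow> state_of C \<in> bv_states M \<and>
     (state_of C \<noteq> bv_init M \<longrightarrow> state_of C \<noteq> bv_final M \<longrightarrow> n = 0)"
  by (auto simp: confs_def qtm_of_bv_def)

lemma sum_delta_ket:
  fixes p :: 'q and v :: "'s::finite" and h :: "'q \<times> 's \<times> dir \<Rightarrow> complex"
  assumes "finite A" "p \<in> A" "h (p, v, d) = 1"
    and "\<And>x. x \<in> A \<times> UNIV \<times> {L, R} \<Longrightarrow> x \<noteq> (p, v, d) \<Longrightarrow> h x = 0"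
  shows "(\<Sum>x\<in>A \<times> UNIV \<times> {L, R}. h x * F x) = F (p, v, d)"
proof -
  have "(\<Sum>x\<in>A \<times> UNIV \<times> {L, R}. h x * F x) = (\<Sum>x\<in>{(p, v, d)}. h x * F x)"
    by (rule sum.mono_neutral_right) (use assms dir.exhaust[of d] in auto)
  then show ?thesis using assms by simp
qed

text \<open>Used for the transitions out of \<open>q\<^sub>f\<close>, and later for all transitions
  of the permutation machine \<open>fresh_final\<close>.\<close>

lemma bv_step_deterministic:
  assumes "finite (bv_states M)" "p \<in> bv_states M"
    and "bv_delta M (state_of C) (current_symbol C) (p, current_symbol C, R) = 1"
    and "\<And>q' a' d. q' \<in> bv_states M \<Longrightarrow> (q', a', d) \<noteq> (p, current_symbol C, R) \<Longrightarrow>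
      bv_delta M (state_of C) (current_symbol C) (q', a', d) = 0"
  shows "bv_step M C = ket (move C p R)"
proof
  fix D
  show "bv_step M C D = ket (move C p R) D"
    unfolding bv_step_def move_def
    using sum_delta_ket[where A = "bv_states M" and p = p and v = "current_symbol C" and d = R
        and h = "bv_delta M (state_of C) (current_symbol C)"
        and F = "\<lambda>(p, v, d). ket (successor C p v d) D"] assms
    by (auto simp: case_prod_unfold)
qed

lemma bv_step_final:
  assumes "is_bv_qtm M" "state_of C = bv_final M"
  shows "bv_step M C = ket (move C (bv_init M) R)"
  using assms by (intro bv_step_deterministic) (auto simp: is_bv_qtm_def)

lemma bv_step_init_eq_0:
  assumes "is_bv_qtm M" "state_of C \<in> bv_states M" "state_of C \<noteq> bv_final M"
    and "state_of D = bv_init M"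
  shows "bv_step M C D = 0"
  unfolding bv_step_def
  by (rule sum.neutral) (use assms in \<open>auto simp: is_bv_qtm_def ket_def\<close>)

text \<open>The sums for the two machines differ only by transitions into \<open>q\<^sub>0\<close>,
  and these have amplitude zero unless they start in \<open>q\<^sub>f\<close>.\<close>

lemma step_qtm_of_bv:
  assumes M: "is_bv_qtm M" "state_of C \<in> bv_states M" "state_of C \<noteq> bv_final M"
  shows "step (qtm_of_bv M) (C, 0) (D, m) = (if m = 0 then bv_step M C D else 0)"
proof -
  have "step (qtm_of_bv M) (C, 0) (D, m) =
    (\<Sum>(p, v, d)\<in>(bv_states M - {bv_init M}) \<times> UNIV \<times> {L, R}.
       bv_delta M (state_of C) (current_symbol C) (p, v, d) * ket (successor C p v d, 0) (D, m))"
    using assms by (simp add: step_def qtm_of_bv_def)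
  also have "\<dots> = (\<Sum>(p, v, d)\<in>bv_states M \<times> UNIV \<times> {L, R}.
       bv_delta M (state_of C) (current_symbol C) (p, v, d) * ket (successor C p v d, 0) (D, m))"
    by (rule sum.mono_neutral_left) (use M in \<open>auto simp: is_bv_qtm_def\<close>)
  also have "\<dots> = (if m = 0 then bv_step M C D else 0)"
    by (auto simp: bv_step_def ket_def intro!: sum.cong sum.neutral)
  finally show ?thesis .
qed

text \<open>
  The evolution of \<open>qtm_of_bv M\<close> first applies that of \<open>M\<close> at counter zero and then pulls back
  along this permutation. It undoes the move that \<open>M\<close> makes from \<open>q\<^sub>f\<close> to \<open>q\<^sub>0\<close>, counting up
  instead.
\<close>

definition reroute :: "('s::tape_alphabet, 'q) bv_machine \<Rightarrow> ('s, 'q) conf \<Rightarrow> ('s, 'q) conf" where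
  "reroute M = (\<lambda>(D, m).
     if state_of D = bv_init M then (D, m + 1)
     else if state_of D = bv_final M \<and> m = 1 then (move D (bv_init M) R, 0)
     else if state_of D = bv_final M \<and> m > 1 then (D, m - 1)
     else (D, m))"

text \<open>The permutation is a shift along two-sided infinite chains: the counter at
  \<open>q\<^sub>f\<close> descends to 1, the next element is the configuration moved into
  \<open>q\<^sub>0\<close> at counter 0, and from there the counter ascends. All other
  configurations, including those in \<open>q\<^sub>f\<close> at counter 0, are fixed.
  \<open>\<rho>\<close> is the shift backwards.\<close>

lemma bij_betw_reroute:
  fixes M :: "('s::tape_alphabet, 'q) bv_machine"
  assumes "is_bv_qtm M" "bv_init M \<noteq> bv_final M"
  shows "bij_betw (reroute M) (confs (qtm_of_bv M)) (confs (qtm_of_bv M))"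
proof -
  define \<rho> where "\<rho> = (\<lambda>(C, n).
     if state_of C = bv_init M then (if n = 0 then (move C (bv_final M) L, 1) else (C, n - 1))
     else if state_of C = bv_final M \<and> n > 0 then (C, n + 1)
     else (C :: ('s, 'q) plain_conf, n :: nat))"
  show ?thesis
  proof (rule bij_betw_byWitness[where f' = \<rho>])
    show "\<forall>y\<in>confs (qtm_of_bv M). \<rho> (reroute M y) = y"
      using assms by (auto simp: reroute_def \<rho>_def move_R_L)
    show "\<forall>y\<in>confs (qtm_of_bv M). reroute M (\<rho> y) = y"
      using assms by (auto simp: reroute_def \<rho>_def move_L_R)
    show "reroute M ` confs (qtm_of_bv M) \<subseteq> confs (qtm_of_bv M)"
      using assms by (auto simp: reroute_def confs_qtm_of_bv is_bv_qtm_def)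
    show "\<rho> ` confs (qtm_of_bv M) \<subseteq> confs (qtm_of_bv M)"
      using assms by (auto simp: \<rho>_def confs_qtm_of_bv is_bv_qtm_def)
  qed
qed

section \<open>Factoring the evolution with counters\<close>

text \<open>A configuration in \<open>q\<^sub>0\<close> is reached only from
  \<open>q\<^sub>f\<close>, and there from a single configuration since the move to the right is
  injective.\<close>

lemma bv_evolution_final:
  assumes M: "is_bv_qtm M" and D: "state_of D = bv_final M"
  shows "bv_evolution M f (move D (bv_init M) R) = f D"
proof -
  have inj: "C = D" if "state_of C = bv_final M" "move C (bv_init M) R = move D (bv_init M) R" for C
    using that D move_R_L by metis
  have "bv_evolution M f (move D (bv_init M) R) = f D * bv_step M D (move D (bv_init M) R)"
    unfolding bv_evolution_def lin_ext_def
  proof (rule infsum_single)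
    show "D \<in> bv_confs M" using M D by (simp add: bv_confs_def is_bv_qtm_def)
    fix C assume C: "C \<in> bv_confs M" "C \<noteq> D"
    show "f C * bv_step M C (move D (bv_init M) R) = 0"
    proof (cases "state_of C = bv_final M")
      case True
      then show ?thesis using C inj[of C] by (auto simp: bv_step_final[OF M] ket_def)
    next
      case False
      then show ?thesis using C by (simp add: bv_confs_def bv_step_init_eq_0[OF M])
    qed
  qed
  then show ?thesis by (simp add: bv_step_final[OF M D] ket_def)
qed

text \<open>Positive counters contribute nothing here: target steps end at a positive counter and
  source steps stay in \<open>q\<^sub>0\<close>. Configurations in \<open>q\<^sub>f\<close> at
  counter zero drop out on both sides, since \<open>M\<close> sends them to \<open>q\<^sub>0\<close>
  and the new machine to counter 1.\<close>

lemma evolution_counter_zero: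
  fixes M :: "('s::tape_alphabet, 'q) bv_machine"
  assumes M: "is_bv_qtm M" and ne: "bv_init M \<noteq> bv_final M"
    and D: "state_of D \<noteq> bv_init M"
  shows "evolution (qtm_of_bv M) f (D, 0) = bv_evolution M (\<lambda>C. f (C, 0)) D"
proof -
  let ?X = "confs (qtm_of_bv M)"
  have "evolution (qtm_of_bv M) f (D, 0) =
      (\<Sum>\<^sub>\<infinity>y\<in>(\<lambda>C. (C, 0)) ` bv_confs M. f y * bv_step M (fst y) D)"
    unfolding evolution_def lin_ext_def
  proof (rule infsum_cong_neutral)
    fix y assume "y \<in> (\<lambda>C. (C, 0)) ` bv_confs M - ?X"
    then show "f y * bv_step M (fst y) D = 0" by (auto simp: bv_confs_def confs_qtm_of_bv)
  next
    fix y assume y: "y \<in> ?X - (\<lambda>C. (C, 0)) ` bv_confs M"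
    obtain C n where [simp]: "y = (C, n)" by (cases y)
    have "n > 0" "state_of C = bv_init M \<or> state_of C = bv_final M"
      using y by (auto simp: bv_confs_def confs_qtm_of_bv)
    then show "f y * step (qtm_of_bv M) y (D, 0) = 0"
      using ne D by (auto simp: step_def qtm_of_bv_def ket_def)
  next
    fix y assume y: "y \<in> ?X \<inter> (\<lambda>C. (C, 0)) ` bv_confs M"
    then obtain C where [simp]: "y = (C, 0)" and C: "state_of C \<in> bv_states M"
      by (auto simp: bv_confs_def)
    show "f y * step (qtm_of_bv M) y (D, 0) = f y * bv_step M (fst y) D"
    proof (cases "state_of C = bv_final M")
      case True
      then show ?thesis
        using D by (auto simp: bv_step_final[OF M] step_def qtm_of_bv_def ket_def)
    next
      case False
      then show ?thesis using C by (simp add: step_qtm_of_bv[OF M])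
    qed
  qed
  also have "\<dots> = bv_evolution M (\<lambda>C. f (C, 0)) D"
    unfolding bv_evolution_def lin_ext_def
    by (subst infsum_reindex) (auto simp: inj_on_def o_def)
  finally show ?thesis .
qed

text \<open>Compared coordinate by coordinate. A configuration in \<open>q\<^sub>0\<close>, or in
  \<open>q\<^sub>f\<close> with positive counter, has exactly one predecessor, given by a counter
  rule; the remaining ones have counter zero and fall under
  \<open>evolution_counter_zero\<close>.\<close>

lemma evolution_qtm_of_bv:
  fixes M :: "('s::tape_alphabet, 'q) bv_machine"
  assumes M: "is_bv_qtm M" and ne: "bv_init M \<noteq> bv_final M"
  shows "evolution (qtm_of_bv M) f = (\<lambda>y. if y \<in> confs (qtm_of_bv M)
           then on_counter_zero (bv_evolution M) f (reroute M y) else 0)"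
proof
  fix y :: "('s, 'q) conf"
  let ?N = "qtm_of_bv M"
  obtain D m where y: "y = (D, m)" by (cases y)
  have ev: "evolution ?N f y = (\<Sum>\<^sub>\<infinity>x\<in>confs ?N. f x * step ?N x y)"
    by (simp add: evolution_def lin_ext_def)
  have target: "step ?N (C, n) = ket (C, n + 1)" if "state_of C = bv_final M" for C n
    using that by (simp add: step_def qtm_of_bv_def)
  have source: "step ?N (C, n) = ket (C, n - 1)" if "state_of C = bv_init M" "n > 0" for C n
    using that ne by (simp add: step_def qtm_of_bv_def)
  \<comment> \<open>Apart from the two counter rules, only ordinary transitions remain; they start
    and end at counter zero.\<close>
  have inner: "step ?N (C, n) (D, m) = (if m = 0 then bv_step M C D else 0) \<and> n = 0"
    if "(C, n) \<in> confs ?N" "state_of C \<noteq> bv_final M" "\<not> (state_of C = bv_init M \<and> n > 0)" for C n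
    using that step_qtm_of_bv[OF M, of C D m] by (auto simp: confs_qtm_of_bv)
  have bv0: "bv_step M C D = 0" if "state_of C \<in> bv_states M" "state_of D \<notin> bv_states M" for C
    unfolding bv_step_def by (rule sum.neutral) (use that in \<open>auto simp: ket_def\<close>)
  consider "y \<notin> confs ?N" | "y \<in> confs ?N" "state_of D = bv_init M"
    | "y \<in> confs ?N" "state_of D = bv_final M" "m > 0"
    | "y \<in> confs ?N" "state_of D \<noteq> bv_init M" "m = 0"
    using confs_qtm_of_bv[of D m M] unfolding y neq0_conv[symmetric] by argo
  then show "evolution ?N f y =
    (if y \<in> confs ?N then on_counter_zero (bv_evolution M) f (reroute M y) else 0)"
  proof cases
    case 1
    have "step ?N x y = 0" if "x \<in> confs ?N" for x
    proof -
      obtain C n where x: "x = (C, n)" by (cases x)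
      consider "state_of C = bv_final M" | "state_of C = bv_init M" "n > 0"
        | "state_of C \<noteq> bv_final M" "\<not> (state_of C = bv_init M \<and> n > 0)" by blast
      then show ?thesis
      proof cases
        case 1
        then show ?thesis using \<open>y \<notin> confs ?N\<close> that
          by (auto simp: x y target ket_def confs_qtm_of_bv)
      next
        case 2
        then show ?thesis using \<open>y \<notin> confs ?N\<close> that
          by (auto simp: x y source ket_def confs_qtm_of_bv)
      next
        case 3
        then show ?thesis using \<open>y \<notin> confs ?N\<close> that inner[of C n] bv0[of C]
          by (auto simp: x y confs_qtm_of_bv)
      qed
    qed
    then have "(\<Sum>\<^sub>\<infinity>x\<in>confs ?N. f x * step ?N x y) = 0" by (intro infsum_0) simp
    then show ?thesis using 1 by (simp add: ev)
  next
    case 2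
    have "evolution ?N f y = f (D, m + 1) * step ?N (D, m + 1) y"
      unfolding ev
    proof (rule infsum_single)
      show "(D, m + 1) \<in> confs ?N" using 2 by (auto simp: y confs_qtm_of_bv)
      fix x assume x: "x \<in> confs ?N" "x \<noteq> (D, m + 1)"
      obtain C n where [simp]: "x = (C, n)" by (cases x)
      consider "state_of C = bv_final M" | "state_of C = bv_init M" "n > 0"
        | "state_of C \<noteq> bv_final M" "\<not> (state_of C = bv_init M \<and> n > 0)" by blast
      then show "f x * step ?N x y = 0"
      proof cases
        case 1
        then show ?thesis using 2 ne by (auto simp: y target ket_def)
      next
        case 2
        then show ?thesis using x by (auto simp: y source ket_def)
      next
        case 3
        then have "bv_step M C D = 0"
          using x \<open>state_of D = bv_init M\<close>
          by (intro bv_step_init_eq_0[OF M]) (auto simp: confs_qtm_of_bv)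
        then show ?thesis using 3 x inner[of C n] by (auto simp: y split: if_splits)
      qed
    qed
    then show ?thesis
      using 2 by (simp add: y source ket_def reroute_def on_counter_zero_simps)
  next
    case 3
    have "evolution ?N f y = f (D, m - 1) * step ?N (D, m - 1) y"
      unfolding ev
    proof (rule infsum_single)
      show "(D, m - 1) \<in> confs ?N" using 3 by (auto simp: y confs_qtm_of_bv)
      fix x assume x: "x \<in> confs ?N" "x \<noteq> (D, m - 1)"
      obtain C n where [simp]: "x = (C, n)" by (cases x)
      consider "state_of C = bv_final M" | "state_of C = bv_init M" "n > 0"
        | "state_of C \<noteq> bv_final M" "\<not> (state_of C = bv_init M \<and> n > 0)" by blast
      then show "f x * step ?N x y = 0"
      proof cases
        case 1
        then show ?thesis using x by (auto simp: y target ket_def)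
      next
        case 2
        then show ?thesis using 3 ne by (auto simp: y source ket_def)
      next
        case 3
        then show ?thesis using x \<open>m > 0\<close> inner[of C n] by (auto simp: y)
      qed
    qed
    \<comment> \<open>For \<open>m = 1\<close>, \<open>reroute\<close> leads to
      \<open>q\<^sub>0\<close> at counter zero, where \<open>bv_evolution_final\<close> returns the
      amplitude of \<open>f\<close> at \<open>(D, 0)\<close>.\<close>
    then show ?thesis
      using 3 ne by (auto simp: y target ket_def reroute_def on_counter_zero_simps
          bv_evolution_final[OF M])
  next
    case 4
    then show ?thesis
      by (simp add: y evolution_counter_zero[OF M ne] reroute_def on_counter_zero_simps)
  qed
qed

text \<open>The factorization presents the evolution as a unitary operator followed by a permutation
  of the basis. Disjointness of sources and targets is
  \<open>q\<^sub>0 \<noteq> q\<^sub>f\<close>.\<close>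

lemma is_qtm_qtm_of_bv:
  fixes M :: "('s::tape_alphabet, 'q) bv_machine"
  assumes M: "is_bv_qtm M" and ne: "bv_init M \<noteq> bv_final M"
  shows "is_qtm (qtm_of_bv M)"
proof -
  have "unitary_on_ell2 (confs (qtm_of_bv M)) (on_counter_zero (bv_evolution M))"
    by (rule unitary_on_counter_zero[where X = "bv_confs M"])
       (use M in \<open>auto simp: confs_qtm_of_bv bv_confs_def is_bv_qtm_def\<close>)
  then have "unitary_on_ell2 (confs (qtm_of_bv M)) (evolution (qtm_of_bv M))"
    unfolding evolution_qtm_of_bv[OF assms]
    using unitary_on_ell2_comp unitary_on_ell2_permute[OF bij_betw_reroute[OF assms]]
    by fastforce
  moreover have "is_pre_qtm (qtm_of_bv M)"
    using M ne by (auto simp: is_pre_qtm_def qtm_of_bv_def is_bv_qtm_def)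
  ultimately show ?thesis by (simp add: is_qtm_def)
qed

section \<open>Agreement of the two machines up to the halting time\<close>

text \<open>At counter zero and outside \<open>q\<^sub>f\<close> both machines have the same
  transitions by \<open>step_qtm_of_bv\<close>, and \<open>\<phi>\<close> has no weight in
  \<open>q\<^sub>f\<close>.\<close>

lemma evolution_with_counter_zero:
  fixes M :: "('s::tape_alphabet, 'q) bv_machine"
  assumes M: "is_bv_qtm M" and ne: "bv_init M \<noteq> bv_final M"
    and \<phi>: "\<And>C. \<phi> C \<noteq> 0 \<Longrightarrow> state_of C \<noteq> bv_final M"
  shows "evolution (qtm_of_bv M) (with_counter_zero \<phi>) = with_counter_zero (bv_evolution M \<phi>)"
proof
  fix y :: "('s, 'q) conf"
  obtain D m where y: "y = (D, m)" by (cases y)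
  have "evolution (qtm_of_bv M) (with_counter_zero \<phi>) y =
      (\<Sum>\<^sub>\<infinity>x\<in>(\<lambda>C. (C, 0::nat)) ` bv_confs M.
        if m = 0 then \<phi> (fst x) * bv_step M (fst x) D else 0)"
    unfolding evolution_def lin_ext_def
  proof (rule infsum_cong_neutral)
    fix x assume "x \<in> (\<lambda>C. (C, 0)) ` bv_confs M - confs (qtm_of_bv M)"
    then show "(if m = 0 then \<phi> (fst x) * bv_step M (fst x) D else 0) = 0"
      by (auto simp: confs_qtm_of_bv bv_confs_def)
  next
    fix x assume "x \<in> confs (qtm_of_bv M) - (\<lambda>C. (C, 0)) ` bv_confs M"
    then show "with_counter_zero \<phi> x * step (qtm_of_bv M) x y = 0"
      by (cases x) (auto simp: with_counter_zero_def confs_qtm_of_bv bv_confs_def)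
  next
    fix x assume "x \<in> confs (qtm_of_bv M) \<inter> (\<lambda>C. (C, 0)) ` bv_confs M"
    then obtain C where x: "x = (C, 0)" "state_of C \<in> bv_states M"
      by (auto simp: bv_confs_def)
    show "with_counter_zero \<phi> x * step (qtm_of_bv M) x y =
        (if m = 0 then \<phi> (fst x) * bv_step M (fst x) D else 0)"
      using \<phi>[of C] x
      by (cases "\<phi> C = 0") (simp_all add: with_counter_zero_def y step_qtm_of_bv[OF M])
  qed
  also have "\<dots> = with_counter_zero (bv_evolution M \<phi>) y"
    by (subst infsum_reindex)
       (auto simp: inj_on_def o_def with_counter_zero_def y bv_evolution_def lin_ext_def)
  finally show "evolution (qtm_of_bv M) (with_counter_zero \<phi>) y =
    with_counter_zero (bv_evolution M \<phi>) y" .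
qed

text \<open>Only the times \<open>i < k\<close> must avoid \<open>q\<^sub>f\<close>: the
  superposition at time \<open>k\<close> may lie in \<open>q\<^sub>f\<close>, as no step is taken
  from it.\<close>

lemma evolution_until_halting:
  assumes M: "is_bv_qtm M" and ne: "bv_init M \<noteq> bv_final M"
    and halt: "\<And>i D. i < k \<Longrightarrow> (bv_evolution M ^^ i) (ket C) D \<noteq> 0 \<Longrightarrow> state_of D \<noteq> bv_final M"
  shows "(evolution (qtm_of_bv M) ^^ k) (ket (C, 0)) =
    with_counter_zero ((bv_evolution M ^^ k) (ket C))"
  using halt
proof (induction k)
  case 0
  then show ?case by (auto simp: ket_def with_counter_zero_def)
next
  case (Suc k)
  have "(evolution (qtm_of_bv M) ^^ k) (ket (C, 0)) =
      with_counter_zero ((bv_evolution M ^^ k) (ket C))"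
    by (rule Suc.IH) (rule Suc.prems, auto)
  then show ?case using evolution_with_counter_zero[OF M ne Suc.prems[of k]] by simp
qed


section \<open>Coinciding initial and final states\<close>

text \<open>
  If \<open>q\<^sub>0 = q\<^sub>f\<close>, then \<open>M\<close> can only halt in zero steps, so any QTM on a superset of its states will do.
\<close>

definition fresh_final :: "('s, 'q) bv_machine \<Rightarrow> 'q \<Rightarrow> ('s, 'q) bv_machine" where
  "fresh_final M t = \<lparr>bv_states = insert t (bv_states M),
     bv_delta = (\<lambda>q a x. if x = (Transposition.transpose (bv_init M) t q, a, R) then 1 else 0),
     bv_init = bv_init M, bv_final = t\<rparr>"

text \<open>Every step moves right over an unchanged tape and swaps \<open>q\<^sub>0\<close> with
  \<open>t\<close>, so the evolution permutes the basis. The swap makes \<open>t\<close> the only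
  state leading into \<open>q\<^sub>0\<close>, as the conditions on the final state require.\<close>

lemma is_bv_qtm_fresh_final:
  fixes M :: "('s::tape_alphabet, 'q) bv_machine"
  assumes fin: "finite (bv_states M)" "bv_init M \<in> bv_states M"
  shows "is_bv_qtm (fresh_final M t)"
proof -
  let ?N = "fresh_final M t" and ?\<tau> = "Transposition.transpose (bv_init M) t"
  have closed: "?\<tau> q \<in> bv_states ?N" if "q \<in> bv_states ?N" for q
    using that fin by (auto simp: fresh_final_def Transposition.transpose_def)
  \<comment> \<open>Both maps use \<open>?\<tau>\<close> because a transposition is its own inverse;
    only the direction is reversed.\<close>
  define \<sigma> \<pi> :: "('s, 'q) plain_conf \<Rightarrow> ('s, 'q) plain_conf"
    where "\<sigma> C = move C (?\<tau> (state_of C)) R" and "\<pi> C = move C (?\<tau> (state_of C)) L" for C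
  have inv: "\<sigma> (\<pi> C) = C" "\<pi> (\<sigma> C) = C" for C
    by (simp_all add: \<sigma>_def \<pi>_def move_R_L move_L_R)
  have mem: "\<sigma> C \<in> bv_confs ?N" "\<pi> C \<in> bv_confs ?N" if "C \<in> bv_confs ?N" for C
    using that closed by (auto simp: bv_confs_def \<sigma>_def \<pi>_def)
  have bij: "bij_betw \<pi> (bv_confs ?N) (bv_confs ?N)"
    by (rule bij_betw_byWitness[where f' = \<sigma>]) (auto simp: inv mem)
  have "bv_step ?N C = ket (\<sigma> C)" if "C \<in> bv_confs ?N" for C
    unfolding \<sigma>_def
    by (rule bv_step_deterministic)
       (use that closed fin in \<open>auto simp: fresh_final_def bv_confs_def\<close>)
  then have "bv_evolution ?N = (\<lambda>f x. if x \<in> bv_confs ?N then f (\<pi> x) else 0)"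
    unfolding bv_evolution_def
    by (intro ext) (subst lin_ext_permute[where \<pi> = \<pi> and \<sigma> = \<sigma>], auto simp: inv mem bij)
  then have "unitary_on_ell2 (bv_confs ?N) (bv_evolution ?N)"
    using unitary_on_ell2_permute[OF bij] by simp
  then show ?thesis
    using fin by (auto simp: is_bv_qtm_def fresh_final_def Transposition.transpose_def split: if_splits)
qed

theorem theorem3p0:
  fixes M :: "('s::tape_alphabet, 'q::infinite) bv_machine"
  assumes "is_bv_qtm M"
  shows "\<exists>M' :: ('s, 'q) qtm_machine.
           is_qtm M' \<and>
           bv_states M \<subseteq> states M' \<and>
           init M' = bv_init M \<and>
           (bv_init M \<noteq> bv_final M \<longrightarrow> final M' = bv_final M) \<and>
           (\<forall>\<alpha> \<beta> k \<phi>.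
              bv_halts_in M k (plain \<alpha> (bv_init M) \<beta>) \<longrightarrow>
              \<phi> = (bv_evolution M ^^ k) (ket (plain \<alpha> (bv_init M) \<beta>)) \<longrightarrow>
              (evolution M' ^^ k) (ket (plain \<alpha> (bv_init M) \<beta>, 0)) = with_counter_zero \<phi>)"
proof (cases "bv_init M = bv_final M")
  case False
  show ?thesis
  proof (intro exI[of _ "qtm_of_bv M"] conjI allI impI)
    show "is_qtm (qtm_of_bv M)" by (rule is_qtm_qtm_of_bv[OF assms False])
    show "bv_states M \<subseteq> states (qtm_of_bv M)" "init (qtm_of_bv M) = bv_init M"
      "final (qtm_of_bv M) = bv_final M" by (simp_all add: qtm_of_bv_def)
    fix \<alpha> \<beta> k \<phi>
    assume "bv_halts_in M k (plain \<alpha> (bv_init M) \<beta>)"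
      and "\<phi> = (bv_evolution M ^^ k) (ket (plain \<alpha> (bv_init M) \<beta>))"
    then show "(evolution (qtm_of_bv M) ^^ k) (ket (plain \<alpha> (bv_init M) \<beta>, 0)) =
        with_counter_zero \<phi>"
      using evolution_until_halting[OF assms False] by (auto simp: bv_halts_in_def)
  qed
next
  case True
  have fin: "finite (bv_states M)" "bv_init M \<in> bv_states M"
    using assms by (auto simp: is_bv_qtm_def)
  then obtain t where t: "t \<notin> bv_states M"
    using ex_new_if_finite[OF infinite_UNIV] by blast
  let ?N = "fresh_final M t"
  have ne: "bv_init ?N \<noteq> bv_final ?N" using fin t by (auto simp: fresh_final_def)
  show ?thesis
  proof (intro exI[of _ "qtm_of_bv ?N"] conjI allI impI)
    show "is_qtm (qtm_of_bv ?N)"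
      by (rule is_qtm_qtm_of_bv[OF is_bv_qtm_fresh_final[OF fin] ne])
    show "bv_states M \<subseteq> states (qtm_of_bv ?N)" "init (qtm_of_bv ?N) = bv_init M"
      by (auto simp: qtm_of_bv_def fresh_final_def)
    show "final (qtm_of_bv ?N) = bv_final M" if "bv_init M \<noteq> bv_final M"
      using that True by simp
    fix \<alpha> \<beta> k \<phi>
    assume halt: "bv_halts_in M k (plain \<alpha> (bv_init M) \<beta>)"
      and \<phi>: "\<phi> = (bv_evolution M ^^ k) (ket (plain \<alpha> (bv_init M) \<beta>))"
    \<comment> \<open>A positive \<open>k\<close> would forbid \<open>q\<^sub>f\<close> at time 0,
      but the input is in \<open>q\<^sub>0 = q\<^sub>f\<close>. With \<open>k = 0\<close> neither
      machine takes a step.\<close>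
    have "k = 0"
    proof (rule ccontr)
      assume "k \<noteq> 0"
      then have "ket (plain \<alpha> (bv_init M) \<beta>) D \<noteq> 0 \<Longrightarrow> state_of D \<noteq> bv_final M" for D
        using halt by (auto simp: bv_halts_in_def dest: spec[of _ 0])
      from this[of "plain \<alpha> (bv_init M) \<beta>"] show False using True by (simp add: ket_def)
    qed
    then show "(evolution (qtm_of_bv ?N) ^^ k) (ket (plain \<alpha> (bv_init M) \<beta>, 0)) =
        with_counter_zero \<phi>"
      using \<phi> by (auto simp: ket_def with_counter_zero_def)
  qed
qed

end
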